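(* Let $U$ be a $\kappa$-cut that is not $(\mathrm{I},\kappa-1)$-small, is not equal to $C(i,j)=C_i\cup T\cup C_j$ for any wheel $(T;C_1,\dots,C_w)$ and indices $i\ne j$, and has a side $A$ with $|A|>2\kappa$. Consider the family $\mathcal L$ of $\kappa$-cuts $W\neq U$ with $W\subseteq U\cup A$ that are not $(\mathrm{I},\kappa-1)$-small; for $W\in\mathcal L$ let $S(W)$ be the side of $W$ containing $U\setminus W$ and all sides of $U$ other than $A$, and let $R(W)$ be the union of all other sides of $W$. Call $W\in\mathcal L$ maximal if there is no $W'\in\mathcal L$, $W'\neq W$, with $R(W)\subseteq R(W')$. 1. If matching cuts of $U$ in side $A$ exist, let $Q=\bigcup_{P\in\Theta^*}P$ and $X=(U\setminus Q)\cup\mathrm{Match}_{U;A}(Q)$. Then every $W\in\mathcal L$ is (i) a laminar cut of $X$ within the region $A\setminus\mathrm{Match}_{U;A}(Q)$ (i.e. $W\subseteq X\cup(A\setminus \mathrm{Match}_{U;A}(Q))$), or (ii) a matching cut of $U$ (in side $A$), or (iii) a crossing matching cut of $X$. 2. If there are no matching cuts of $U$ in side $A$, then every $W\in\mathcal L$ is either maximal or is a laminar cut of some maximal $W_i\in\mathcal L$ in a side of $W_i$ contained in $R(W_i)$; moreover, for any two distinct maximal $W_i,W_j\in\mathcal L$, $R(W_i)\cap R(W_j)=\emptyset$.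
   Context: Standing conventions: $G=(V,E)$ is a finite, simple, connected, undirected, non-complete graph with $n=|V|$; $\kappa$ is its vertex connectivity, assumed $\kappa<n/4$. A cut is a set $U\subset V$ whose removal disconnects $G$; a $\kappa$-cut is a cut of size $\kappa$; a side of $U$ is a connected component of the subgraph induced on $V\setminus U$. A laminar cut of $U$ in side $P$ is a cut $W\subseteq U\cup P$. A cut with sides $A_1,\dots,A_a$ is $(\mathrm{I},t)$-small if $\sum_{i\ne i^\sharp}|A_i|\le t$ for some index $i^\sharp$. Wheels: for $w\ge4$ (indices modulo $w$), if $V$ is partitioned into pairwise disjoint sets $T,C_1,\dots,C_w,S_1,\dots,S_w$ with all $C_i,S_i$ nonempty ($T$ may be empty) such that for every $i$, $C_i\cup T\cup C_{i+2}$ is a $\kappa$-cut disconnecting $S_i\cup C_{i+1}\cup S_{i+1}$ from the rest of the graph (i.e. every path from that set to the remaining vertices outside the cut meets the cut), then $(T;C_1,\dots,C_w)$ forms a $w$-wheel. Matching cuts: for a cut $U$, a side $A$ of $U$, and $P\subseteq U$, a $\kappa$-cut $W$ is a matching cut of $U$ in side $A$ w.r.t. $P$ if (i) $U\setminus P\subseteq W\subseteq U\cup A$, (ii) $A\setminus W\neq\emptyset$, (iii) $P\cup(V\setminus(U\cup A))$ and $A\setminus W$ are disjoint from $W$ and every path between them meets $W$; then $\mathrm{Match}_{U;A}(P)=W\setminus U$. If a cut $Y$ has exactly two sides $A',B'$ and $\emptyset\ne P\subseteq Y$, a $\kappa$-cut $W$ is a crossing matching cut of $Y$ in side $A'$ w.r.t.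 $P$ if $W\cap B'\ne\emptyset$ and $(Y\setminus P)\cup(W\cap A')$ is a matching cut of $Y$ in side $A'$ w.r.t. $P$; "a crossing matching cut of $Y$" means one in some side w.r.t. some such $P$. $\Theta=\{P\subseteq U:\text{a matching cut of }U\text{ in side }A\text{ w.r.t. }P\text{ exists}\}$, $\Theta^*=\{\bigcap\{P\in\Theta:u\in P\}: u\in U\text{ lies in some member of }\Theta\}$. *)

theory Defs
  imports Main
begin

definition simple_graph :: "('a \<Rightarrow> 'a \<Rightarrow> bool) \<Rightarrow> 'a set \<Rightarrow> bool" where
  "simple_graph E V \<longleftrightarrow> finite V \<and>
     (\<forall>x y. E x y \<longrightarrow> x \<in> V \<and> y \<in> V \<and> x \<noteq> y \<and> E y x)"

definition reach :: "('a \<Rightarrow> 'a \<Rightarrow> bool) \<Rightarrow> 'a set \<Rightarrow> 'a \<Rightarrow> 'a \<Rightarrow> bool" where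
  "reach E S x y \<longleftrightarrow> x \<in> S \<and> y \<in> S \<and> (\<lambda>u v. E u v \<and> u \<in> S \<and> v \<in> S)\<^sup>*\<^sup>* x y"

definition graph_connected :: "('a \<Rightarrow> 'a \<Rightarrow> bool) \<Rightarrow> 'a set \<Rightarrow> bool" where
  "graph_connected E V \<longleftrightarrow> V \<noteq> {} \<and> (\<forall>x\<in>V. \<forall>y\<in>V. reach E V x y)"

definition graph_complete :: "('a \<Rightarrow> 'a \<Rightarrow> bool) \<Rightarrow> 'a set \<Rightarrow> bool" where
  "graph_complete E V \<longleftrightarrow> (\<forall>x\<in>V. \<forall>y\<in>V. x \<noteq> y \<longrightarrow> E x y)"

definition sides :: "('a \<Rightarrow> 'a \<Rightarrow> bool) \<Rightarrow> 'a set \<Rightarrow> 'a set \<Rightarrow> 'a set set" where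
  "sides E V U = {C. \<exists>x\<in>V - U. C = {y. reach E (V - U) x y}}"

definition is_cut :: "('a \<Rightarrow> 'a \<Rightarrow> bool) \<Rightarrow> 'a set \<Rightarrow> 'a set \<Rightarrow> bool" where
  "is_cut E V U \<longleftrightarrow> U \<subseteq> V \<and> 2 \<le> card (sides E V U)"

text \<open>Vertex connectivity (minimum size of a cut; G is non-complete).\<close>
definition kappa :: "('a \<Rightarrow> 'a \<Rightarrow> bool) \<Rightarrow> 'a set \<Rightarrow> nat" where
  "kappa E V = Min {card U | U. is_cut E V U}"

definition kcut :: "('a \<Rightarrow> 'a \<Rightarrow> bool) \<Rightarrow> 'a set \<Rightarrow> 'a set \<Rightarrow> bool" where
  "kcut E V U \<longleftrightarrow> is_cut E V U \<and> card U = kappa E V"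

definition small_I :: "('a \<Rightarrow> 'a \<Rightarrow> bool) \<Rightarrow> 'a set \<Rightarrow> 'a set \<Rightarrow> nat \<Rightarrow> bool" where
  "small_I E V U t \<longleftrightarrow>
     (\<exists>Ash\<in>sides E V U. (\<Sum>C\<in>sides E V U - {Ash}. card C) \<le> t)"

definition separates :: "('a \<Rightarrow> 'a \<Rightarrow> bool) \<Rightarrow> 'a set \<Rightarrow> 'a set \<Rightarrow> 'a set \<Rightarrow> 'a set \<Rightarrow> bool" where
  "separates E V W X Y \<longleftrightarrow> X \<inter> W = {} \<and> Y \<inter> W = {} \<and>
     (\<forall>x\<in>X. \<forall>y\<in>Y. \<not> reach E (V - W) x y)"

text \<open>(T; C_0,...,C_{w-1}) forms a w-wheel (indices taken modulo w, shifted to start at 0).\<close>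
definition is_wheel :: "('a \<Rightarrow> 'a \<Rightarrow> bool) \<Rightarrow> 'a set \<Rightarrow> nat \<Rightarrow> 'a set \<Rightarrow> (nat \<Rightarrow> 'a set) \<Rightarrow> bool" where
  "is_wheel E V w T C \<longleftrightarrow> 4 \<le> w \<and>
     (\<exists>S :: nat \<Rightarrow> 'a set.
        V = T \<union> (\<Union>i<w. C i) \<union> (\<Union>i<w. S i) \<and>
        (\<forall>i<w. C i \<noteq> {} \<and> S i \<noteq> {} \<and> T \<inter> C i = {} \<and> T \<inter> S i = {}) \<and>
        (\<forall>i<w. \<forall>j<w. C i \<inter> S j = {}) \<and>
        (\<forall>i<w. \<forall>j<w. i \<noteq> j \<longrightarrow> C i \<inter> C j = {} \<and> S i \<inter> S j = {}) \<and>
        (\<forall>i<w. let K = C i \<union> T \<union> C ((i + 2) mod w);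
                   Z = S i \<union> C ((i + 1) mod w) \<union> S ((i + 1) mod w)
               in kcut E V K \<and> separates E V K Z (V - (K \<union> Z))))"

definition matching_cut :: "('a \<Rightarrow> 'a \<Rightarrow> bool) \<Rightarrow> 'a set \<Rightarrow> 'a set \<Rightarrow> 'a set \<Rightarrow> 'a set \<Rightarrow> 'a set \<Rightarrow> bool" where
  "matching_cut E V U A P W \<longleftrightarrow>
     is_cut E V U \<and> A \<in> sides E V U \<and> P \<noteq> {} \<and> P \<subseteq> U \<and> kcut E V W \<and>
     U - P \<subseteq> W \<and> W \<subseteq> U \<union> A \<and> A - W \<noteq> {} \<and>
     separates E V W (P \<union> (V - (U \<union> A))) (A - W)"

definition Match :: "('a \<Rightarrow> 'a \<Rightarrow> bool) \<Rightarrow> 'a set \<Rightarrow> 'a set \<Rightarrow> 'a set \<Rightarrow> 'a set \<Rightarrow> 'a set" where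
  "Match E V U A P = (SOME W. matching_cut E V U A P W) - U"

definition Theta :: "('a \<Rightarrow> 'a \<Rightarrow> bool) \<Rightarrow> 'a set \<Rightarrow> 'a set \<Rightarrow> 'a set \<Rightarrow> 'a set set" where
  "Theta E V U A = {P. P \<subseteq> U \<and> (\<exists>W. matching_cut E V U A P W)}"

definition Theta_star :: "('a \<Rightarrow> 'a \<Rightarrow> bool) \<Rightarrow> 'a set \<Rightarrow> 'a set \<Rightarrow> 'a set \<Rightarrow> 'a set set" where
  "Theta_star E V U A =
     {\<Inter>{P \<in> Theta E V U A. u \<in> P} | u. u \<in> U \<and> (\<exists>P\<in>Theta E V U A. u \<in> P)}"

definition crossing_matching_cut :: "('a \<Rightarrow> 'a \<Rightarrow> bool) \<Rightarrow> 'a set \<Rightarrow> 'a set \<Rightarrow> 'a set \<Rightarrow> bool" where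
  "crossing_matching_cut E V Y W \<longleftrightarrow>
     is_cut E V Y \<and> card (sides E V Y) = 2 \<and>
     (\<exists>A' B' P. sides E V Y = {A', B'} \<and> A' \<noteq> B' \<and> P \<noteq> {} \<and> P \<subseteq> Y \<and>
        kcut E V W \<and> W \<inter> B' \<noteq> {} \<and>
        matching_cut E V Y A' P ((Y - P) \<union> (W \<inter> A')))"

definition famL :: "('a \<Rightarrow> 'a \<Rightarrow> bool) \<Rightarrow> 'a set \<Rightarrow> 'a set \<Rightarrow> 'a set \<Rightarrow> 'a set set" where
  "famL E V U A = {W. kcut E V W \<and> W \<noteq> U \<and> W \<subseteq> U \<union> A \<and> \<not> small_I E V W (kappa E V - 1)}"

definition sideS :: "('a \<Rightarrow> 'a \<Rightarrow> bool) \<Rightarrow> 'a set \<Rightarrow> 'a set \<Rightarrow> 'a set \<Rightarrow> 'a set \<Rightarrow> 'a set" where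
  "sideS E V U A W = (THE C. C \<in> sides E V W \<and> (U - W) \<union> (V - (U \<union> A)) \<subseteq> C)"

definition sideR :: "('a \<Rightarrow> 'a \<Rightarrow> bool) \<Rightarrow> 'a set \<Rightarrow> 'a set \<Rightarrow> 'a set \<Rightarrow> 'a set \<Rightarrow> 'a set" where
  "sideR E V U A W = \<Union>(sides E V W - {sideS E V U A W})"

definition maximalL :: "('a \<Rightarrow> 'a \<Rightarrow> bool) \<Rightarrow> 'a set \<Rightarrow> 'a set \<Rightarrow> 'a set \<Rightarrow> 'a set \<Rightarrow> bool" where
  "maximalL E V U A W \<longleftrightarrow> W \<in> famL E V U A \<and>
     \<not> (\<exists>W'\<in>famL E V U A. W' \<noteq> W \<and> sideR E V U A W \<subseteq> sideR E V U A W')"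

end

theory Submission
  imports Defs
begin

text \<open>
  Submodularity: if two minimum cuts cross so that two opposite corners are nonempty, then the
  boundaries of both corners are minimum cuts. Hence the sets \<open>P\<close> admitting a matching cut are
  closed under union, so \<open>X\<close> is itself the matching cut with respect to \<open>Q\<close>. If \<open>W\<close> meets \<open>Q\<close>,
  uncrossing \<open>X\<close> with \<open>W\<close> makes the four arms of the crossing pairwise equal in size: either
  \<open>S(W)\<close> avoids \<open>A\<close> and \<open>W\<close> is a matching cut of \<open>U\<close>, or the counts force \<open>A - X\<close> to be
  connected and \<open>W\<close> is a crossing matching cut of \<open>X\<close>. If there is no matching cut and
  \<open>R(W1)\<close>, \<open>R(W2)\<close> meet, the corner cut bounding \<open>S(W1) \<inter> S(W2)\<close> is a larger member of the
  family unless it equals \<open>U\<close>; in that case all four corners are nonempty and \<open>U\<close> consists of two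
  adjacent spokes and the hub of a 4-wheel.
\<close>

locale finite_simple_graph =
  fixes E :: "'a \<Rightarrow> 'a \<Rightarrow> bool" and V :: "'a set"
  assumes simple: "simple_graph E V"
begin

abbreviation "\<kappa> \<equiv> kappa E V"

lemma finite_V: "finite V"
  using simple by (simp add: simple_graph_def)

lemma edge_sym: "E x y \<Longrightarrow> E y x"
  using simple by (simp add: simple_graph_def)

lemma edge_in_V: "E x y \<Longrightarrow> y \<in> V"
  using simple by (auto simp add: simple_graph_def)

lemma finite_subset_V: "X \<subseteq> V \<Longrightarrow> finite X"
  using finite_V finite_subset by blast

subsection \<open>Unions of sides\<close>

text \<open>These are exactly the unions of sides of \<open>K\<close>, the empty union included.
  Phrasing this as closure under edges outside \<open>K\<close> turns complements, intersections and
  corners into plain set algebra, without paths.\<close>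

definition detached :: "'a set \<Rightarrow> 'a set \<Rightarrow> bool" where
  "detached K X \<longleftrightarrow> X \<subseteq> V - K \<and> (\<forall>x\<in>X. \<forall>y\<in>V - K. E x y \<longrightarrow> y \<in> X)"

lemma detached_subset: "detached K X \<Longrightarrow> X \<subseteq> V - K"
  by (simp add: detached_def)

lemma detached_compl: "detached K X \<Longrightarrow> detached K (V - K - X)"
  using edge_sym unfolding detached_def by blast

lemma detached_Int: "detached K X \<Longrightarrow> detached K Y \<Longrightarrow> detached K (X \<inter> Y)"
  unfolding detached_def by blast

lemma detached_Diff: "detached K X \<Longrightarrow> detached K Y \<Longrightarrow> detached K (X - Y)"
  using edge_sym unfolding detached_def by blast

lemma reach_detached:
  assumes "detached K X" "x \<in> X" "reach E (V - K) x y"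
  shows "y \<in> X"
proof -
  have "(\<lambda>u v. E u v \<and> u \<in> V - K \<and> v \<in> V - K)\<^sup>*\<^sup>* x y"
    using assms(3) by (simp add: reach_def)
  then show ?thesis
    by (induction rule: rtranclp_induct) (use assms in \<open>auto simp: detached_def\<close>)
qed

lemma detached_component: "detached K {y. reach E (V - K) x y}"
  unfolding detached_def reach_def by (auto intro: rtranclp.rtrancl_into_rtrancl)

lemma detached_side: "D \<in> sides E V K \<Longrightarrow> detached K D"
  unfolding sides_def using detached_component by blast

lemma side_nonempty: "D \<in> sides E V K \<Longrightarrow> D \<noteq> {}"
  unfolding sides_def reach_def by auto

lemma side_subset: "D \<in> sides E V K \<Longrightarrow> D \<subseteq> V - K"
  using detached_side detached_subset by blast

lemma reach_sym:
  assumes "reach E S x y" shows "reach E S y x"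
proof -
  have "symp (\<lambda>u v. E u v \<and> u \<in> S \<and> v \<in> S)"
    using edge_sym by (auto intro: sympI)
  then have "symp (\<lambda>u v. E u v \<and> u \<in> S \<and> v \<in> S)\<^sup>*\<^sup>*"
    by (rule symp_rtranclp)
  then show ?thesis
    using assms unfolding reach_def by (auto dest: sympD)
qed

lemma side_subset_or_disjoint:
  assumes D: "D \<in> sides E V K" and X: "detached K X"
  shows "D \<subseteq> X \<or> D \<inter> X = {}"
proof -
  obtain x where D': "D = {y. reach E (V - K) x y}"
    using D unfolding sides_def by blast
  have "D \<subseteq> X" if "y \<in> D" "y \<in> X" for y
  proof
    fix z assume "z \<in> D"
    have "reach E (V - K) y x" "reach E (V - K) x z"
      using D' that \<open>z \<in> D\<close> reach_sym by auto
    then show "z \<in> X" using reach_detached[OF X] that(2) by blast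
  qed
  then show ?thesis by blast
qed

lemma sides_disjoint:
  assumes C: "C \<in> sides E V K" and D: "D \<in> sides E V K" and "C \<noteq> D"
  shows "C \<inter> D = {}"
  using side_subset_or_disjoint[OF C detached_side[OF D]]
    side_subset_or_disjoint[OF D detached_side[OF C]] \<open>C \<noteq> D\<close> by blast

lemma in_some_side: "x \<in> V - K \<Longrightarrow> \<exists>D\<in>sides E V K. x \<in> D"
  unfolding sides_def by (intro bexI[of _ "{y. reach E (V - K) x y}"]) (auto simp: reach_def)

lemma Union_sides: "\<Union>(sides E V K) = V - K"
proof
  show "\<Union>(sides E V K) \<subseteq> V - K" by (rule Union_least) (rule side_subset)
  show "V - K \<subseteq> \<Union>(sides E V K)" using in_some_side by (intro subsetI) (simp add: Bex_def)
qed

lemma Union_other_sides: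
  assumes D: "D \<in> sides E V K"
  shows "\<Union>(sides E V K - {D}) = V - K - D"
proof -
  have "C \<inter> D = {}" if "C \<in> sides E V K - {D}" for C
    using that sides_disjoint[OF _ D] by simp
  then have "\<Union>(sides E V K - {D}) \<inter> D = {}" by (simp add: Int_commute disjoint_iff) blast
  moreover have "\<Union>(sides E V K - {D}) \<union> D = V - K" unfolding Union_sides[symmetric] using D by blast
  ultimately show ?thesis by blast
qed

lemma finite_sides: "finite (sides E V K)"
proof (rule finite_subset)
  show "sides E V K \<subseteq> Pow V" using side_subset by blast
qed (simp add: finite_V)

text \<open>Converse of the dichotomy \<open>side_subset_or_disjoint\<close>: a nonempty union of
  sides that no other union of sides splits is a single side. Connectedness of the two sides of
  \<open>X\<close> is later proved in this form.\<close>

lemma sideI: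
  assumes "detached K X" "X \<noteq> {}"
    and "\<And>Y. detached K Y \<Longrightarrow> Y \<inter> X \<noteq> {} \<Longrightarrow> X \<subseteq> Y"
  shows "X \<in> sides E V K"
proof -
  obtain x where "x \<in> X" using assms(2) by blast
  then have "x \<in> V - K" using detached_subset[OF assms(1)] by blast
  then obtain D where D: "D \<in> sides E V K" "x \<in> D" using in_some_side by blast
  then have "X \<subseteq> D" using assms(3)[of D] detached_side \<open>x \<in> X\<close> by blast
  moreover have "D \<subseteq> X" using side_subset_or_disjoint[OF D(1) assms(1)] D(2) \<open>x \<in> X\<close> by blast
  ultimately show ?thesis using D(1) by simp
qed

lemma not_small_I_iff:
  "\<not> small_I E V K t \<longleftrightarrow> (\<forall>D\<in>sides E V K. t < card (V - K - D))"
proof -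
  have "(\<Sum>C\<in>sides E V K - {D}. card C) = card (V - K - D)" if "D \<in> sides E V K" for D
  proof -
    have "card (\<Union>(sides E V K - {D})) = (\<Sum>C\<in>sides E V K - {D}. card C)"
    proof (rule card_Union_disjoint)
      show "pairwise disjnt (sides E V K - {D})"
        using sides_disjoint by (auto simp: pairwise_def disjnt_def)
      show "finite C" if "C \<in> sides E V K - {D}" for C
        using that side_subset[of C K] finite_subset_V by blast
    qed
    then show ?thesis using Union_other_sides[OF that] by simp
  qed
  then show ?thesis unfolding small_I_def by (auto simp: not_le)
qed

lemma is_cutI:
  assumes "K \<subseteq> V" "detached K X" "X \<noteq> {}" "V - K - X \<noteq> {}"
  shows "is_cut E V K"
proof -
  obtain x where x: "x \<in> X" using assms(3) by blast
  obtain y where y: "y \<in> V - K - X" using assms(4) by blast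
  obtain C where C: "C \<in> sides E V K" "x \<in> C"
    using in_some_side[of x K] x detached_subset[OF assms(2)] by blast
  obtain D where D: "D \<in> sides E V K" "y \<in> D" using in_some_side[of y K] y by blast
  have "C \<noteq> D" using side_subset_or_disjoint[OF C(1) assms(2)] C(2) D(2) x y by blast
  then have "card {C, D} = 2" by simp
  moreover have "card {C, D} \<le> card (sides E V K)"
    using C(1) D(1) finite_sides by (intro card_mono) auto
  ultimately show ?thesis unfolding is_cut_def using assms(1) by simp
qed

lemma is_cut_other_sides:
  assumes "is_cut E V K" "D \<in> sides E V K" shows "V - K - D \<noteq> {}"
proof
  assume "V - K - D = {}"
  then have "C = D" if "C \<in> sides E V K" for C
    using Union_other_sides[OF assms(2)] that side_nonempty[OF that] by blast
  then have "sides E V K \<subseteq> {D}" by blast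
  then have "card (sides E V K) \<le> 1"
    by (metis card_mono card.empty card_insert_disjoint empty_iff finite.emptyI finite.insertI One_nat_def)
  then show False using assms(1) unfolding is_cut_def by simp
qed

section \<open>Minimum cuts and their neighbours\<close>

lemma kcut_subset: "kcut E V K \<Longrightarrow> K \<subseteq> V"
  by (simp add: kcut_def is_cut_def)

lemma kcut_finite: "kcut E V K \<Longrightarrow> finite K"
  using kcut_subset finite_subset_V by blast

lemma kcut_card: "kcut E V K \<Longrightarrow> card K = \<kappa>"
  by (simp add: kcut_def)

lemma kcut_eqI: "kcut E V K \<Longrightarrow> kcut E V L \<Longrightarrow> K \<subseteq> L \<Longrightarrow> K = L"
  by (simp add: card_subset_eq kcut_card kcut_finite)

lemma kappa_le:
  assumes "is_cut E V K" shows "\<kappa> \<le> card K"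
  unfolding kappa_def
proof (rule Min_le)
  have "{card U |U. is_cut E V U} \<subseteq> card ` Pow V" by (auto simp: is_cut_def)
  then show "finite {card U |U. is_cut E V U}"
    using finite_V by (meson finite_Pow_iff finite_imageI finite_subset)
  show "card K \<in> {card U |U. is_cut E V U}" using assms by blast
qed

text \<open>Otherwise \<open>k\<close> could join the part outside \<open>X\<close>, and
  \<open>K - {k}\<close> would be a cut with fewer than \<kappa> vertices.\<close>

lemma kcut_neighbour:
  assumes K: "kcut E V K" and X: "detached K X" "X \<noteq> {}" "V - K - X \<noteq> {}" and k: "k \<in> K"
  shows "\<exists>x\<in>X. E k x"
proof (rule ccontr)
  assume none: "\<not> (\<exists>x\<in>X. E k x)"
  have "detached (K - {k}) X"
    using X(1) none edge_sym unfolding detached_def by blast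
  then have "is_cut E V (K - {k})"
    using X(2,3) kcut_subset[OF K] by (intro is_cutI) auto
  then have "\<kappa> \<le> card (K - {k})" by (rule kappa_le)
  moreover have "card (K - {k}) < card K"
    using k kcut_finite[OF K] by (intro psubset_card_mono) auto
  ultimately show False using kcut_card[OF K] by simp
qed

lemma kcut_subset_neighbours:
  assumes "kcut E V K" "detached K X" "X \<noteq> {}" "V - K - X \<noteq> {}" "detached L Y" "X \<subseteq> Y"
  shows "K \<subseteq> L \<union> Y"
  using kcut_neighbour[OF assms(1-4)] assms(5,6) kcut_subset[OF assms(1)] edge_sym
  unfolding detached_def by blast

lemma separates_detached:
  assumes "detached K X" "X \<inter> Y = {}" "Y \<inter> K = {}"
  shows "separates E V K X Y"
  using assms reach_detached[OF assms(1)] detached_subset[OF assms(1)]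
  unfolding separates_def by blast

lemma separates_compl_detached:
  assumes "detached K X" "Y \<inter> K = {}" "X \<inter> Y = {}"
  shows "separates E V K Y X"
  using separates_detached[OF assms(1,3,2)] reach_sym unfolding separates_def by blast

lemma detached_if_separates:
  assumes "separates E V K Y X" "V - K = Y \<union> X"
  shows "detached K X"
  unfolding detached_def
proof (intro conjI ballI impI)
  show "X \<subseteq> V - K" using assms(2) by blast
  fix x y assume h: "x \<in> X" "y \<in> V - K" "E x y"
  show "y \<in> X"
  proof (rule ccontr)
    assume "y \<notin> X"
    then have "y \<in> Y" using h(2) assms(2) by blast
    moreover have "x \<in> V - K" using assms(2) h(1) by blast
    then have "reach E (V - K) y x"
      unfolding reach_def using h edge_sym by auto
    ultimately show False using assms(1) h(1) unfolding separates_def by blast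
  qed
qed

subsection \<open>Uncrossing\<close>

text \<open>For \<open>X\<close> detached from \<open>K\<close> and \<open>Y\<close> from
  \<open>L\<close>, this is where edges leaving \<open>X \<inter> Y\<close> can end: the arm of
  \<open>K\<close> inside \<open>Y\<close>, the hub \<open>K \<inter> L\<close>, and the arm of
  \<open>L\<close> inside \<open>X\<close>.\<close>

definition corner :: "'a set \<Rightarrow> 'a set \<Rightarrow> 'a set \<Rightarrow> 'a set \<Rightarrow> 'a set" where
  "corner K X L Y = (K \<inter> Y) \<union> (K \<inter> L) \<union> (L \<inter> X)"

lemma detached_corner:
  "detached K X \<Longrightarrow> detached L Y \<Longrightarrow> detached (corner K X L Y) (X \<inter> Y)"
  unfolding detached_def corner_def by blast

lemma card_corner:
  assumes "K \<subseteq> V" "L \<subseteq> V" "detached K X" "detached L Y"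
  shows "card (corner K X L Y) = card (K \<inter> Y) + card (K \<inter> L) + card (L \<inter> X)"
proof -
  have fin: "finite K" "finite L" using assms finite_subset_V by auto
  have "Y \<inter> L = {}" "X \<inter> K = {}" using assms detached_subset by blast+
  then have "(K \<inter> Y) \<inter> (K \<inter> L) = {}" "((K \<inter> Y) \<union> (K \<inter> L)) \<inter> (L \<inter> X) = {}" by blast+
  then show ?thesis unfolding corner_def using fin by (simp add: card_Un_disjoint)
qed

text \<open>One-sided form of submodularity: a single nonempty corner and any vertex outside it and
  both cuts suffice, so it still applies where the opposite corner may be empty.\<close>

lemma kappa_le_corner:
  assumes "K \<subseteq> V" "L \<subseteq> V" "detached K X" "detached L Y"
    and "X \<inter> Y \<noteq> {}" "V - (K \<union> L) - X \<inter> Y \<noteq> {}"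
  shows "\<kappa> \<le> card (K \<inter> Y) + card (K \<inter> L) + card (L \<inter> X)"
proof -
  have "is_cut E V (corner K X L Y)"
    using assms by (intro is_cutI[OF _ detached_corner]) (auto simp: corner_def)
  then show ?thesis using kappa_le card_corner assms(1-4) by metis
qed

lemma card_split:
  assumes "K \<subseteq> V" "detached L Y"
  shows "card K = card (K \<inter> Y) + card (K \<inter> L) + card (K \<inter> (V - L - Y))"
proof -
  have "finite K" using assms finite_subset_V by auto
  moreover have "K = (K \<inter> Y) \<union> (K \<inter> L) \<union> (K \<inter> (V - L - Y))" using assms(1) by blast
  moreover have "(K \<inter> Y) \<inter> (K \<inter> L) = {}" using detached_subset[OF assms(2)] by blast
  moreover have "((K \<inter> Y) \<union> (K \<inter> L)) \<inter> (K \<inter> (V - L - Y)) = {}" by blast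
  ultimately show ?thesis by (metis card_Un_disjoint finite_Un)
qed

text \<open>The boundaries of two opposite corners together have size
  \<open>card K + card L\<close>, which is twice \<kappa>, and each is a cut of size at least
  \<kappa>. Hence both bounds are tight, which also equates the arms in pairs.\<close>

lemma uncross:
  assumes K: "kcut E V K" and L: "kcut E V L" and X: "detached K X" and Y: "detached L Y"
    and XY: "X \<inter> Y \<noteq> {}" and XY': "(V - K - X) \<inter> (V - L - Y) \<noteq> {}"
  shows "kcut E V (corner K X L Y)"
    and "card (K \<inter> Y) = card (L \<inter> (V - K - X))"
    and "card (L \<inter> X) = card (K \<inter> (V - L - Y))"
proof -
  note sub = kcut_subset[OF K] kcut_subset[OF L]
  have dd: "V - K - (V - K - X) = X" "V - L - (V - L - Y) = Y"
    using detached_subset[OF X] detached_subset[OF Y] by blast+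
  have 1: "\<kappa> \<le> card (K \<inter> Y) + card (K \<inter> L) + card (L \<inter> X)"
    using XY' by (intro kappa_le_corner[OF sub X Y XY]) blast
  have 2: "\<kappa> \<le> card (K \<inter> (V - L - Y)) + card (K \<inter> L) + card (L \<inter> (V - K - X))"
    using XY dd by (intro kappa_le_corner[OF sub detached_compl[OF X] detached_compl[OF Y] XY']) blast
  have 3: "\<kappa> = card (K \<inter> Y) + card (K \<inter> L) + card (K \<inter> (V - L - Y))"
    using card_split[OF sub(1) Y] kcut_card[OF K] by simp
  have 4: "\<kappa> = card (L \<inter> X) + card (K \<inter> L) + card (L \<inter> (V - K - X))"
    using card_split[OF sub(2) X] kcut_card[OF L] by (simp add: Int_commute)
  show "card (K \<inter> Y) = card (L \<inter> (V - K - X))" "card (L \<inter> X) = card (K \<inter> (V - L - Y))"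
    using 1 2 3 4 by linarith+
  have "card (corner K X L Y) = \<kappa>"
    using card_corner[OF sub X Y] 1 2 3 4 by linarith
  moreover have "is_cut E V (corner K X L Y)"
    using XY XY' sub by (intro is_cutI[OF _ detached_corner[OF X Y]]) (auto simp: corner_def)
  ultimately show "kcut E V (corner K X L Y)" by (simp add: kcut_def)
qed

lemma four_wheel_corner:
  assumes K: "kcut E V K" and L: "kcut E V L" and KL: "K \<noteq> L"
    and X: "detached K X" and Y: "detached L Y"
    and c: "X \<inter> Y \<noteq> {}" "(V - K - X) \<inter> (V - L - Y) \<noteq> {}"
      "X \<inter> (V - L - Y) \<noteq> {}" "(V - K - X) \<inter> Y \<noteq> {}"
  shows "\<exists>w T C i j. is_wheel E V w T C \<and> i < w \<and> j < w \<and> i \<noteq> j \<and>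
           corner K X L Y = C i \<union> T \<union> C j"
proof -
  let ?X' = "V - K - X" and ?Y' = "V - L - Y"
  have X': "detached K ?X'" "V - K - ?X' = X"
    using detached_compl[OF X] detached_subset[OF X] by auto
  have Y': "detached L ?Y'" "V - L - ?Y' = Y"
    using detached_compl[OF Y] detached_subset[OF Y] by auto
  note subK = kcut_subset[OF K] and subL = kcut_subset[OF L]
  have 1: "card (K \<inter> Y) = card (L \<inter> ?X')" "card (L \<inter> X) = card (K \<inter> ?Y')"
    using uncross(2,3)[OF K L X Y c(1,2)] by auto
  \<comment> \<open>Uncrossing along the other diagonal; with the first diagonal this makes all four
    arms equally large, so an empty arm would force \<open>K = L\<close>.\<close>
  have 2: "card (K \<inter> ?Y') = card (L \<inter> ?X')" "card (L \<inter> X) = card (K \<inter> Y)"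
    using uncross(2,3)[OF K L X Y'(1) c(3)] Y'(2) c(4) by auto
  have K_split: "card K = card (K \<inter> Y) + card (K \<inter> L) + card (K \<inter> ?Y')"
    using card_split[OF subK Y] .
  have pos: "card (K \<inter> Y) > 0"
  proof (rule ccontr)
    assume "\<not> 0 < card (K \<inter> Y)"
    then have "card (K \<inter> L) = card K" using K_split 1 2 by linarith
    then have "K \<inter> L = K" using kcut_finite[OF K] by (intro card_subset_eq) auto
    then show False using kcut_eqI[OF K L] KL by blast
  qed
  have ne: "K \<inter> Y \<noteq> {}" "L \<inter> X \<noteq> {}" "K \<inter> ?Y' \<noteq> {}" "L \<inter> ?X' \<noteq> {}"
    using pos 1 2 by fastforce+
  let ?T = "K \<inter> L"
  \<comment> \<open>Cyclic order around the hub: \<open>C 0\<close> and \<open>C 2\<close> are the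
    arms of \<open>K\<close>, \<open>C 1\<close> and \<open>C 3\<close> those of \<open>L\<close>,
    and \<open>S i\<close> is the corner between \<open>C i\<close> and its successor. Opposite
    spokes with the hub thus give back \<open>K\<close> or \<open>L\<close>.\<close>
  define C where "C i = [K \<inter> Y, L \<inter> X, K \<inter> ?Y', L \<inter> ?X'] ! i" for i
  define S where "S i = [X \<inter> Y, X \<inter> ?Y', ?X' \<inter> ?Y', ?X' \<inter> Y] ! i" for i
  have CS: "C 0 = K \<inter> Y" "C 1 = L \<inter> X" "C 2 = K \<inter> ?Y'" "C 3 = L \<inter> ?X'"
    "S 0 = X \<inter> Y" "S 1 = X \<inter> ?Y'" "S 2 = ?X' \<inter> ?Y'" "S 3 = ?X' \<inter> Y"
    by (simp_all add: C_def S_def)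
  have mods: "(0 + 2) mod 4 = (2::nat)" "(1 + 2) mod 4 = (3::nat)" "(2 + 2) mod 4 = (0::nat)"
    "(3 + 2) mod 4 = (1::nat)" "(0 + 1) mod 4 = (1::nat)" "(1 + 1) mod 4 = (2::nat)"
    "(2 + 1) mod 4 = (3::nat)" "(3 + 1) mod 4 = (0::nat)" by simp_all
  have four: "(\<forall>i<4. P i) \<longleftrightarrow> P 0 \<and> P 1 \<and> P 2 \<and> P (3::nat)" for P :: "nat \<Rightarrow> bool"
    by (auto simp: less_Suc_eq numeral_eq_Suc)
  have four_Un: "(\<Union>i<4. F i) = F 0 \<union> F 1 \<union> F 2 \<union> F (3::nat)" for F :: "nat \<Rightarrow> 'a set"
    by (auto simp: less_Suc_eq numeral_eq_Suc)
  have dX: "X \<subseteq> V - K" and dY: "Y \<subseteq> V - L" using detached_subset X Y by auto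
  have sepK: "separates E V K Z (V - (K \<union> Z))" if "detached K Z" for Z K
    by (rule separates_detached[OF that]) auto
  have K_eq: "K \<inter> Y \<union> ?T \<union> K \<inter> ?Y' = K" "K \<inter> ?Y' \<union> ?T \<union> K \<inter> Y = K" using subK by blast+
  have L_eq: "L \<inter> X \<union> ?T \<union> L \<inter> ?X' = L" "L \<inter> ?X' \<union> ?T \<union> L \<inter> X = L" using subL by blast+
  have Z_eq: "X \<inter> Y \<union> L \<inter> X \<union> X \<inter> ?Y' = X" "X \<inter> ?Y' \<union> K \<inter> ?Y' \<union> ?X' \<inter> ?Y' = ?Y'"
    "?X' \<inter> ?Y' \<union> L \<inter> ?X' \<union> ?X' \<inter> Y = ?X'" "?X' \<inter> Y \<union> K \<inter> Y \<union> X \<inter> Y = Y"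
    using dX dY by blast+
  have "is_wheel E V 4 ?T C"
    unfolding is_wheel_def
  proof (intro conjI exI[of _ S])
    show "V = ?T \<union> (\<Union>i<4. C i) \<union> (\<Union>i<4. S i)"
      unfolding four_Un CS using subK subL dX dY by blast
    show "\<forall>i<4. C i \<noteq> {} \<and> S i \<noteq> {} \<and> ?T \<inter> C i = {} \<and> ?T \<inter> S i = {}"
      unfolding four CS using ne c dX dY by blast
    show "\<forall>i<4. \<forall>j<4. C i \<inter> S j = {}"
      unfolding four CS using dX dY by blast
    show "\<forall>i<4. \<forall>j<4. i \<noteq> j \<longrightarrow> C i \<inter> C j = {} \<and> S i \<inter> S j = {}"
      unfolding four CS using dX dY by blast
    show "\<forall>i<4. let K' = C i \<union> ?T \<union> C ((i + 2) mod 4);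
        Z = S i \<union> C ((i + 1) mod 4) \<union> S ((i + 1) mod 4)
      in kcut E V K' \<and> separates E V K' Z (V - (K' \<union> Z))"
      unfolding four Let_def mods CS K_eq L_eq Z_eq
      using K L sepK[OF X] sepK[OF Y] sepK[OF X'(1)] sepK[OF Y'(1)] by (intro conjI)
  qed simp
  moreover have "corner K X L Y = C 0 \<union> ?T \<union> C 1" unfolding CS by (simp add: corner_def)
  ultimately show ?thesis
    by (intro exI[of _ 4] exI[of _ ?T] exI[of _ C] exI[of _ 0] exI[of _ 1]) simp
qed

subsection \<open>Matching cuts\<close>

lemma matching_cutI:
  assumes "is_cut E V Y" "A \<in> sides E V Y" "P \<noteq> {}" "P \<subseteq> Y" "kcut E V W"
    and "W \<inter> Y = Y - P" "W \<subseteq> Y \<union> A" "A - W \<noteq> {}" "detached W (A - W)"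
  shows "matching_cut E V Y A P W"
proof -
  have "separates E V W (P \<union> (V - (Y \<union> A))) (A - W)"
    using assms(4,6,7) side_subset[OF assms(2)]
    by (intro separates_compl_detached[OF assms(9)]) blast+
  then show ?thesis unfolding matching_cut_def using assms by blast
qed

text \<open>The two separated sets exhaust \<open>V - W\<close>, so condition (iii) says that
  \<open>A - W\<close> is a union of sides of \<open>W\<close>. In this form matching cuts can be
  uncrossed.\<close>

lemma matching_cutD:
  assumes "matching_cut E V Y A P W"
  shows "P \<noteq> {}" "P \<subseteq> Y" "kcut E V W" "W \<inter> Y = Y - P" "W \<subseteq> Y \<union> A" "A - W \<noteq> {}"
    "detached W (A - W)" "V - W - (A - W) = P \<union> (V - (Y \<union> A))"
proof -
  have sep: "separates E V W (P \<union> (V - (Y \<union> A))) (A - W)"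
    and Y: "Y \<subseteq> V" "A \<in> sides E V Y"
    and *: "P \<noteq> {}" "P \<subseteq> Y" "kcut E V W" "Y - P \<subseteq> W" "W \<subseteq> Y \<union> A" "A - W \<noteq> {}"
    using assms unfolding matching_cut_def is_cut_def by auto
  have A: "A \<subseteq> V - Y" using side_subset[OF Y(2)] .
  have PW: "P \<inter> W = {}" using sep unfolding separates_def by blast
  show "P \<noteq> {}" "P \<subseteq> Y" "kcut E V W" "W \<subseteq> Y \<union> A" "A - W \<noteq> {}" by fact+
  show "W \<inter> Y = Y - P" using PW * by blast
  have eq: "V - W = (P \<union> (V - (Y \<union> A))) \<union> (A - W)" using PW * A Y by blast
  show "detached W (A - W)" by (rule detached_if_separates[OF sep eq])
  show "V - W - (A - W) = P \<union> (V - (Y \<union> A))" using eq A * by blast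
qed

end

section \<open>The fixed cut \<open>U\<close> with its side \<open>A\<close>, and the sides
  \<open>S W\<close> and \<open>R W\<close> of cuts inside \<open>U \<union> A\<close>\<close>

locale cut_with_side = finite_simple_graph +
  fixes U A :: "'a set"
  assumes Ucut: "kcut E V U" and Aside: "A \<in> sides E V U"
begin

abbreviation "B \<equiv> V - (U \<union> A)"

lemma U_subset: "U \<subseteq> V" using kcut_subset[OF Ucut] .

lemma A_subset: "A \<subseteq> V - U" using side_subset[OF Aside] .

lemma B_eq: "B = V - U - A" by blast

lemma Union_sides_not_A: "\<Union>(sides E V U - {A}) = B"
  using Union_other_sides[OF Aside] B_eq by simp

lemma U_is_cut: "is_cut E V U" using Ucut by (simp add: kcut_def)

lemma B_nonempty: "B \<noteq> {}"
  using is_cut_other_sides[OF U_is_cut Aside] B_eq by simp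

text \<open>Sides of \<open>U\<close> other than \<open>A\<close> avoid \<open>W\<close> and so stay
  connected. By minimality each vertex of \<open>U\<close> has a neighbour in every side of
  \<open>U\<close>, so a single vertex of \<open>U - W\<close> ties all these sides, and then the
  rest of \<open>U - W\<close>, together.\<close>

lemma outer_subset_detached:
  assumes W: "kcut E V W" "W \<noteq> U" "W \<subseteq> U \<union> A" and X: "detached W X"
    and meets: "X \<inter> ((U - W) \<union> B) \<noteq> {}"
  shows "(U - W) \<union> B \<subseteq> X"
proof -
  have side_in: "D \<subseteq> X" if D: "D \<in> sides E V U" "D \<noteq> A" and "D \<inter> X \<noteq> {}" for D
  proof -
    have "D \<inter> A = {}" using sides_disjoint[OF D(1) Aside D(2)] .
    then have DW: "D \<inter> W = {}" using side_subset[OF D(1)] W(3) by blast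
    have "detached U (X \<inter> D)"
      using X detached_side[OF D(1)] DW unfolding detached_def by blast
    then show ?thesis using side_subset_or_disjoint[OF D(1)] that(3) by blast
  qed
  have nb: "\<exists>x\<in>D. E u x" if "D \<in> sides E V U" "u \<in> U" for D u
    using kcut_neighbour[OF Ucut detached_side side_nonempty] is_cut_other_sides[OF U_is_cut] that
    by blast
  have DV: "D \<subseteq> V - W" if "D \<in> sides E V U" "D \<noteq> A" for D
    using sides_disjoint[OF that(1) Aside that(2)] side_subset[OF that(1)] W(3) by blast
  have from_U: "(U - W) \<union> B \<subseteq> X" if u: "u \<in> X" "u \<in> U - W" for u
  proof -
    have all: "D \<subseteq> X" if D: "D \<in> sides E V U" "D \<noteq> A" for D
    proof (rule side_in[OF D])
      obtain x where "x \<in> D" "E u x" using nb[OF D(1)] u by blast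
      then have "x \<in> X" using X u(1) DV[OF D] unfolding detached_def by blast
      then show "D \<inter> X \<noteq> {}" using \<open>x \<in> D\<close> by blast
    qed
    have BX: "B \<subseteq> X" unfolding Union_sides_not_A[symmetric] using all by (intro Union_least) simp
    moreover have "U - W \<subseteq> X"
    proof
      fix v assume v: "v \<in> U - W"
      have "V - U - B = A" using A_subset by blast
      then have "\<exists>x\<in>B. E v x"
        using kcut_neighbour[OF Ucut detached_compl[OF detached_side[OF Aside]], of v]
          B_nonempty v side_nonempty[OF Aside] unfolding B_eq by simp
      then obtain x where "x \<in> B" "E v x" by blast
      then show "v \<in> X" using BX X v U_subset edge_sym unfolding detached_def by blast
    qed
    ultimately show ?thesis by blast
  qed
  \<comment> \<open>Such a tying vertex exists because \<open>U\<close> and \<open>W\<close> are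
    distinct and equally large.\<close>
  have "\<not> U \<subseteq> W" using kcut_eqI[OF Ucut W(1)] W(2) by blast
  then obtain u where u: "u \<in> U - W" by blast
  show ?thesis
  proof (cases "X \<inter> (U - W) = {}")
    case False
    then show ?thesis using from_U by blast
  next
    case True
    then obtain b where b: "b \<in> X" "b \<in> B" using meets by blast
    then have "b \<in> \<Union>(sides E V U - {A})" unfolding Union_sides_not_A by blast
    then obtain D where D: "D \<in> sides E V U" "D \<noteq> A" "b \<in> D" by blast
    have "D \<subseteq> X" using side_in[OF D(1,2)] D(3) b(1) by blast
    obtain x where "x \<in> D" "E u x" using nb[OF D(1)] u by blast
    then have "u \<in> X"
      using \<open>D \<subseteq> X\<close> X u U_subset edge_sym unfolding detached_def by blast
    then show ?thesis using from_U u by blast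
  qed
qed

abbreviation "S W \<equiv> sideS E V U A W"
abbreviation "R W \<equiv> sideR E V U A W"

context
  fixes W
  assumes W: "kcut E V W" "W \<noteq> U" "W \<subseteq> U \<union> A"
begin

text \<open>Justifies the \<open>THE\<close> in \<open>sideS\<close>: the side through one vertex of
  \<open>B\<close> works, and since \<open>B\<close> is nonempty and sides are disjoint, no other
  side does.\<close>

lemma sideS_props: "S W \<in> sides E V W \<and> (U - W) \<union> B \<subseteq> S W"
proof -
  obtain b where b: "b \<in> B" using B_nonempty by blast
  then obtain D where D: "D \<in> sides E V W" "b \<in> D"
    using in_some_side[of b W] W(3) by blast
  have sub: "(U - W) \<union> B \<subseteq> D"
    using outer_subset_detached[OF W detached_side[OF D(1)]] D(2) b by blast
  show ?thesis unfolding sideS_def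
  proof (rule theI[of _ D])
    show "D \<in> sides E V W \<and> (U - W) \<union> B \<subseteq> D" using D(1) sub by blast
    fix C assume "C \<in> sides E V W \<and> (U - W) \<union> B \<subseteq> C"
    then show "C = D" using sides_disjoint[of C W D] D b by blast
  qed
qed

lemmas S_side = sideS_props[THEN conjunct1]
lemmas outer_subset_S = sideS_props[THEN conjunct2]

lemma R_eq: "R W = V - W - S W"
  unfolding sideR_def using Union_other_sides[OF S_side] .

lemma S_eq: "S W = V - W - R W"
  unfolding R_eq using side_subset[OF S_side] by blast

lemma detached_S: "detached W (S W)" using detached_side[OF S_side] .

lemma detached_R: "detached W (R W)" using detached_compl[OF detached_S] R_eq by simp

lemma R_nonempty: "R W \<noteq> {}"
  using is_cut_other_sides[OF _ S_side] W(1) R_eq by (simp add: kcut_def)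

lemma R_subset: "R W \<subseteq> A - W"
  unfolding R_eq using outer_subset_S by blast

lemma B_subset_S: "B \<subseteq> S W"
  using outer_subset_S by blast

lemma S_nonempty: "S W \<noteq> {}"
  using side_nonempty[OF S_side] .

text \<open>If \<open>S W\<close> misses \<open>A\<close>, then \<open>A - W\<close> is all of
  \<open>R W\<close>, which is detached. This is how matching cuts of \<open>U\<close> are
  recognised below.\<close>

lemma matching_cut_if_S_disjoint:
  assumes "S W \<inter> A = {}"
  shows "matching_cut E V U A (U - W) W"
proof (rule matching_cutI[OF U_is_cut Aside])
  show "U - W \<noteq> {}" using kcut_eqI[OF Ucut W(1)] W(2) by blast
  have "A - W = R W" unfolding R_eq using outer_subset_S assms A_subset by blast
  then show "A - W \<noteq> {}" "detached W (A - W)" using R_nonempty detached_R by auto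
qed (use W in auto)

end

text \<open>The size bound is non-smallness read at the side \<open>S W\<close>, whose removal
  leaves exactly \<open>R W\<close>.\<close>

lemma famLD:
  assumes "W \<in> famL E V U A"
  shows "kcut E V W" "W \<noteq> U" "W \<subseteq> U \<union> A" "\<kappa> \<le> card (R W)"
proof -
  show W: "kcut E V W" "W \<noteq> U" "W \<subseteq> U \<union> A"
    using assms unfolding famL_def by auto
  have "\<not> small_I E V W (\<kappa> - 1)" using assms unfolding famL_def by auto
  then have "\<kappa> - 1 < card (V - W - S W)" using S_side[OF W] not_small_I_iff by blast
  then show "\<kappa> \<le> card (R W)" using R_eq[OF W] by simp
qed

subsection \<open>Laminar structure when some matching cut exists\<close>

text \<open>Since \<open>A\<close> has more than 2\<kappa> vertices, \<open>W1\<close> and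
  \<open>W2\<close> cannot cover it, so the inner corner is nonempty; the opposite corner contains
  \<open>B\<close>. The inner corner's boundary loses exactly \<open>P1 \<union> P2\<close> from
  \<open>U\<close>.\<close>

lemma matching_cut_Un:
  assumes big: "2 * \<kappa> < card A"
    and 1: "matching_cut E V U A P1 W1" and 2: "matching_cut E V U A P2 W2"
  shows "\<exists>W. matching_cut E V U A (P1 \<union> P2) W"
proof -
  note d1 = matching_cutD[OF 1] and d2 = matching_cutD[OF 2]
  let ?W = "corner W1 (A - W1) W2 (A - W2)"
  have meet: "(A - W1) \<inter> (A - W2) = A - ?W"
    unfolding corner_def by blast
  have ne: "(A - W1) \<inter> (A - W2) \<noteq> {}"
  proof
    assume "(A - W1) \<inter> (A - W2) = {}"
    then have "A \<subseteq> W1 \<union> W2" by blast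
    then have "card A \<le> card (W1 \<union> W2)"
      using kcut_finite d1(3) d2(3) by (intro card_mono) auto
    also have "\<dots> \<le> card W1 + card W2" by (rule card_Un_le)
    finally show False using big kcut_card d1(3) d2(3) by simp
  qed
  have "kcut E V ?W"
    using d1(3,7,8) d2(3,7,8) ne B_nonempty by (intro uncross(1)) blast+
  moreover have "detached ?W (A - ?W)"
    using detached_corner[OF d1(7) d2(7)] meet by simp
  moreover have "?W \<inter> U = U - (P1 \<union> P2)" using d1(4) d2(4) A_subset unfolding corner_def by blast
  moreover have "?W \<subseteq> U \<union> A" using d1(5) unfolding corner_def by blast
  ultimately have "matching_cut E V U A (P1 \<union> P2) ?W"
    using ne meet d1(1,2) d2(2) by (intro matching_cutI[OF U_is_cut Aside]) auto
  then show ?thesis by blast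
qed

text \<open>Each intersection contains the vertex \<open>u\<close> defining it and lies inside a
  member of \<open>Theta\<close>, so passing to these atoms keeps the union.\<close>

lemma Union_Theta_star: "\<Union>(Theta_star E V U A) = \<Union>(Theta E V U A)"
  unfolding Theta_star_def by (auto simp: Theta_def)

lemma matching_cut_Union_Theta_star:
  assumes big: "2 * \<kappa> < card A" and ex: "\<exists>P W. matching_cut E V U A P W"
  shows "\<exists>W. matching_cut E V U A (\<Union>(Theta_star E V U A)) W"
proof -
  have "finite (Theta E V U A)"
  proof (rule finite_subset)
    show "Theta E V U A \<subseteq> Pow U" by (auto simp: Theta_def)
  qed (simp add: kcut_finite[OF Ucut])
  moreover have "Theta E V U A \<noteq> {}"
    using ex by (auto simp: Theta_def dest: matching_cutD(2))
  moreover have "\<exists>W. matching_cut E V U A (\<Union>F) W"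
    if "finite F" "F \<noteq> {}" "F \<subseteq> Theta E V U A" for F
    using that
  proof (induction F rule: finite_ne_induct)
    case (singleton P)
    then show ?case by (simp add: Theta_def)
  next
    case (insert P F)
    then obtain W1 W2 where "matching_cut E V U A P W1" "matching_cut E V U A (\<Union>F) W2"
      by (auto simp: Theta_def)
    then show ?case using matching_cut_Un[OF big, of P W1 "\<Union>F" W2] by simp
  qed
  ultimately show ?thesis unfolding Union_Theta_star by blast
qed

text \<open>\<open>X\<close> is uncrossed with \<open>W\<close>: the outside of \<open>X\<close>
  splits into the inner part \<open>A0\<close> and the outer part \<open>B0\<close>, and
  \<open>W\<close> meets \<open>B0\<close> because it meets \<open>Q\<close>. The result then
  depends on whether \<open>S W\<close> meets \<open>X\<close>.\<close>

lemma crossing_or_matching: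
  assumes big: "2 * \<kappa> < card A" and X: "matching_cut E V U A Q X"
    and WL: "W \<in> famL E V U A" and WQ: "W \<inter> Q \<noteq> {}"
  shows "(\<exists>P. matching_cut E V U A P W) \<or> crossing_matching_cut E V X W"
proof -
  note dX = matching_cutD[OF X] and W = famLD(1-3)[OF WL]
  define A0 where "A0 = A - X"
  define B0 where "B0 = Q \<union> B"
  have X_neq: "X \<noteq> U" using dX(1,2,4) by blast
  have A0: "A0 \<noteq> {}" "detached X A0" "V - X - A0 = B0"
    using dX(6-8) unfolding A0_def B0_def by auto
  have B0: "detached X B0" "V - X - B0 = A0"
    using detached_compl[OF A0(2)] A0(3) detached_subset[OF A0(2)] by auto
  have S: "V - W - R W = S W" using S_eq[OF W] by simp
  have R: "V - W - S W = R W" using R_eq[OF W] by simp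
  have RA: "R W \<subseteq> A - W" using R_subset[OF W] .
  have BS: "B \<subseteq> S W" using B_subset_S[OF W] .
  note subX = kcut_subset[OF dX(3)] and subW = kcut_subset[OF W(1)]
  have finX: "finite X" and finW: "finite W" using kcut_finite dX(3) W(1) by auto
  have WB: "card (W \<inter> B0) > 0" using WQ finW unfolding B0_def by (auto simp: card_gt_0_iff)
  have BB: "B0 \<inter> S W \<noteq> {}" using BS B_nonempty unfolding B0_def by blast
  have "B0 \<inter> A = {}" using dX(2) A_subset unfolding B0_def by blast
  then have BR: "B0 \<inter> R W = {}" using RA by blast
  have splitW: "card W = card (W \<inter> A0) + card (X \<inter> W) + card (W \<inter> B0)"
    using card_split[OF subW A0(2)] A0(3) by (simp add: Int_commute)
  have splitX: "card X = card (X \<inter> R W) + card (X \<inter> W) + card (X \<inter> S W)"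
    using card_split[OF subX detached_R[OF W]] S by simp
  note cards = kcut_card[OF dX(3)] kcut_card[OF W(1)]
  have BXW: "B \<subseteq> V - (X \<union> W)" using W(3) dX(5) by blast
  have outside: "V - (X \<union> W) - D \<inter> Y \<noteq> {}" if "D \<subseteq> A" for D Y
    using BXW that B_nonempty by blast
  have A0S: "\<kappa> \<le> card (X \<inter> S W) + card (X \<inter> W) + card (W \<inter> A0)" if "A0 \<inter> S W \<noteq> {}"
    using kappa_le_corner[OF subX subW A0(2) detached_S[OF W] that outside] A0_def by blast
  \<comment> \<open>Here the size bound on \<open>R W\<close> enters: were \<open>R W\<close>
    disjoint from \<open>A0\<close>, it would be contained in \<open>X\<close> and thus equal to it.
    Then either \<open>X\<close> and \<open>W\<close> cover \<open>A\<close>, which is too large, or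
    \<open>A0S\<close> contradicts that \<open>W\<close> meets \<open>B0\<close>.\<close>
  have RA0: "A0 \<inter> R W \<noteq> {}"
  proof
    assume A0R: "A0 \<inter> R W = {}"
    then have RX: "R W \<subseteq> X" using RA unfolding A0_def by blast
    then have "R W = X"
      using famLD(4)[OF WL] finX cards(1) by (intro card_seteq) auto
    then have XS: "X \<inter> S W = {}" "X \<inter> W = {}" using RA S by blast+
    have "A0 \<inter> S W \<noteq> {}"
    proof
      assume "A0 \<inter> S W = {}"
      then have "A \<subseteq> X \<union> W"
        using A0R S A_subset unfolding A0_def by blast
      then have "card A \<le> card (X \<union> W)" using finX finW by (intro card_mono) auto
      then show False using card_Un_le[of X W] cards big by linarith
    qed
    then show False using A0S XS splitW cards WB by simp
  qed
  have eqs: "card (X \<inter> R W) = card (W \<inter> B0)" "card (W \<inter> A0) = card (X \<inter> S W)"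
    \<comment> \<open>The opposite nonempty corners are \<open>A0 \<inter> R W\<close> and
      \<open>B0 \<inter> S W\<close>.\<close>
    using uncross(2,3)[OF dX(3) W(1) A0(2) detached_R[OF W] RA0] A0(3) S BB by auto
  show ?thesis
  proof (cases "X \<inter> S W = {}")
    case True
    \<comment> \<open>Otherwise this corner would have a boundary inside
      \<open>X \<inter> W\<close>, which is smaller than \<kappa> since \<open>W\<close> meets
      \<open>B0\<close>.\<close>
    then have "A0 \<inter> S W = {}" using A0S eqs splitW cards WB by fastforce
    then have "S W \<inter> A = {}" using True unfolding A0_def by blast
    then show ?thesis using matching_cut_if_S_disjoint[OF W] by blast
  next
    case False
    then have XS: "card (X \<inter> S W) > 0" using finX by (simp add: card_gt_0_iff)
    have XR: "X \<inter> R W \<noteq> {}" using eqs(1) WB by auto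
    \<comment> \<open>Counting at the corner with \<open>R W\<close>: a part of \<open>A0\<close> meeting \<open>R W\<close> contains all of
      \<open>W \<inter> A0\<close>, whereas every part has to meet \<open>R W\<close>, being adjacent to \<open>X \<inter> R W\<close>.\<close>
    have part: "W \<inter> A0 \<subseteq> D" if D: "detached X D" "D \<subseteq> A0" "D \<inter> R W \<noteq> {}" for D
    proof -
      have "\<kappa> \<le> card (X \<inter> R W) + card (X \<inter> W) + card (W \<inter> D)"
        using kappa_le_corner[OF subX subW D(1) detached_R[OF W] D(3) outside] D(2) A0_def by blast
      then have "card (W \<inter> A0) \<le> card (W \<inter> D)" using splitX cards eqs by linarith
      moreover have "W \<inter> D \<subseteq> W \<inter> A0" using D(2) by blast
      ultimately have "W \<inter> D = W \<inter> A0" using finW by (intro card_seteq) auto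
      then show ?thesis by blast
    qed
    have not_both: False
      if D: "detached X D" "D \<subseteq> A0" "D \<inter> R W \<noteq> {}" and D': "detached X D'" "D' \<subseteq> A0" "D' \<noteq> {}"
        and disj: "D \<inter> D' = {}" for D D'
    proof -
      obtain x where x: "x \<in> X \<inter> R W" using XR by blast
      have "V - X - D' \<noteq> {}" using D(2,3) disj detached_subset[OF D(1)] by blast
      then obtain d where d: "d \<in> D'" "E x d" using kcut_neighbour[OF dX(3) D'(1,3)] x by blast
      have "d \<notin> W" using part[OF D] D'(2) d(1) disj by blast
      then have "d \<in> R W"
        using detached_R[OF W] x d edge_in_V[OF d(2)] unfolding detached_def by blast
      then have "D' \<inter> R W \<noteq> {}" using d(1) by blast
      then have "W \<inter> A0 \<subseteq> D \<inter> D'" using part D D' by blast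
      then have "card (W \<inter> A0) = 0" using disj by simp
      then show False using eqs(2) XS by simp
    qed
    have A0_side: "A0 \<in> sides E V X"
    proof (rule sideI[OF A0(2,1)])
      fix Y assume Y: "detached X Y" "Y \<inter> A0 \<noteq> {}"
      let ?D = "A0 \<inter> Y" and ?D' = "A0 - Y"
      have D: "detached X ?D" "?D \<noteq> {}" "?D \<subseteq> A0" using detached_Int[OF A0(2) Y(1)] Y(2) by auto
      have D': "detached X ?D'" "?D' \<subseteq> A0" using detached_Diff[OF A0(2) Y(1)] by auto
      show "A0 \<subseteq> Y"
      proof (rule ccontr)
        assume "\<not> A0 \<subseteq> Y"
        then have "?D' \<noteq> {}" by blast
        moreover have "?D \<inter> R W \<noteq> {} \<or> ?D' \<inter> R W \<noteq> {}" using RA0 by blast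
        ultimately show False using not_both[of ?D ?D'] not_both[of ?D' ?D] D D' by blast
      qed
    qed
    have B0_side: "B0 \<in> sides E V X"
    proof (rule sideI[OF B0(1)])
      show "B0 \<noteq> {}" using BB by blast
      \<comment> \<open>Written this way, \<open>B0\<close> is the outer set of the cut
        \<open>X\<close> itself, which \<open>outer_subset_detached\<close> shows cannot be
        split.\<close>
      have B0_eq: "B0 = (U - X) \<union> B" using dX(2,4) unfolding B0_def by blast
      show "B0 \<subseteq> Y" if "detached X Y" "Y \<inter> B0 \<noteq> {}" for Y
        using outer_subset_detached[OF dX(3) X_neq dX(5) that(1)] that(2) unfolding B0_eq by simp
    qed
    have AB: "B0 \<noteq> A0" using BB A0(1,3) by blast
    have sidesX: "sides E V X = {B0, A0}"
    proof
      show "sides E V X \<subseteq> {B0, A0}"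
      proof
        fix D assume D: "D \<in> sides E V X"
        then have "D \<inter> A0 \<noteq> {} \<or> D \<inter> B0 \<noteq> {}"
          using side_subset[OF D] side_nonempty[OF D] A0(3) by blast
        then show "D \<in> {B0, A0}"
          using sides_disjoint[OF D A0_side] sides_disjoint[OF D B0_side] by blast
      qed
    qed (use A0_side B0_side in blast)
    \<comment> \<open>Boundary of the corner \<open>B0 \<inter> S W\<close>: in \<open>X\<close> the
      part \<open>X \<inter> R W\<close> is exchanged for \<open>W \<inter> B0\<close>. In the
      definition of a crossing matching cut, \<open>B0\<close> becomes A', \<open>A0\<close> becomes
      B', and \<open>X \<inter> R W\<close> becomes \<open>P\<close>.\<close>
    let ?K = "(X - X \<inter> R W) \<union> (W \<inter> B0)"
    have K: "?K = corner X B0 W (S W)" unfolding corner_def S[symmetric] using subX RA by blast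
    have kK: "kcut E V ?K"
      unfolding K using uncross(1)[OF dX(3) W(1) B0(1) detached_S[OF W] BB] B0(2) R RA0 by simp
    have B0K: "B0 - ?K = B0 \<inter> S W"
      unfolding S[symmetric] using BR detached_subset[OF B0(1)] by blast
    have X_is_cut: "is_cut E V X" using dX(3) by (simp add: kcut_def)
    have "matching_cut E V X B0 (X \<inter> R W) ?K"
    proof (rule matching_cutI[OF X_is_cut B0_side XR _ kK])
      show "?K \<inter> X = X - X \<inter> R W" using detached_subset[OF B0(1)] by blast
      show "B0 - ?K \<noteq> {}" using B0K BB by simp
      show "detached ?K (B0 - ?K)"
        using detached_corner[OF B0(1) detached_S[OF W]] unfolding B0K unfolding K .
    qed blast+
    moreover have "W \<inter> A0 \<noteq> {}" using XS eqs(2) by auto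
    moreover have "card (sides E V X) = 2" using sidesX AB by simp
    moreover have "X \<inter> R W \<subseteq> X" by blast
    ultimately have "crossing_matching_cut E V X W"
      unfolding crossing_matching_cut_def
      by (intro conjI exI[of _ B0] exI[of _ A0] exI[of _ "X \<inter> R W"] X_is_cut sidesX AB XR W(1))
    then show ?thesis ..
  qed
qed

subsection \<open>Disjointness of maximal cuts when there is no matching cut\<close>

text \<open>By minimality every vertex of \<open>W\<close> has a neighbour in \<open>R W\<close>,
  hence in \<open>R W'\<close>, and edges leaving \<open>R W'\<close> end in
  \<open>W'\<close>.\<close>

lemma sideR_mono_subset:
  assumes W: "kcut E V W" "W \<noteq> U" "W \<subseteq> U \<union> A" and W': "kcut E V W'" "W' \<noteq> U" "W' \<subseteq> U \<union> A"
    and sub: "R W \<subseteq> R W'"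
  shows "W \<subseteq> W' \<union> R W'"
  using kcut_subset_neighbours[OF W(1) detached_R[OF W] R_nonempty[OF W] _ detached_R[OF W'] sub]
    S_eq[OF W] S_nonempty[OF W] by simp

lemma sideR_inj:
  assumes W: "kcut E V W" "W \<noteq> U" "W \<subseteq> U \<union> A" and W': "kcut E V W'" "W' \<noteq> U" "W' \<subseteq> U \<union> A"
    and eq: "R W = R W'"
  shows "W = W'"
proof -
  have "W \<subseteq> W' \<union> R W'" using sideR_mono_subset[OF W W'] eq by simp
  moreover have "W \<inter> R W = {}" using R_subset[OF W] by blast
  ultimately show ?thesis using kcut_eqI[OF W(1) W'(1)] eq by blast
qed

lemma below_maximal:
  assumes "W \<in> famL E V U A"
  shows "\<exists>W'. maximalL E V U A W' \<and> R W \<subseteq> R W'"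
  using assms
proof (induction "card (V - R W)" arbitrary: W rule: less_induct)
  case less
  show ?case
  proof (cases "maximalL E V U A W")
    case True
    then show ?thesis by blast
  next
    case False
    then obtain W' where W': "W' \<in> famL E V U A" "W' \<noteq> W" "R W \<subseteq> R W'"
      using less.prems unfolding maximalL_def by blast
    \<comment> \<open>Maximality is stated with non-strict inclusion; injectivity of
      \<open>R\<close> makes it strict, so the measure decreases.\<close>
    have "R W \<noteq> R W'" using sideR_inj famLD(1-3) less.prems W'(1,2) by metis
    moreover have "R W' \<subseteq> V" using R_subset[OF famLD(1-3)[OF W'(1)]] A_subset by blast
    ultimately have "card (V - R W') < card (V - R W)"
      using W'(3) finite_V by (intro psubset_card_mono) auto
    then show ?thesis using less.hyps[OF _ W'(1)] W'(3) by blast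
  qed
qed

text \<open>\<open>R W'\<close> may consist of several sides. If \<open>D\<close> is one that meets
  \<open>R W\<close>, the boundary of \<open>D \<inter> R W\<close> has no vertex in
  \<open>W' \<inter> R W\<close>, so it lies within \<open>W\<close>; needing \<kappa> vertices, it
  is all of \<open>W\<close>.\<close>

lemma laminar_in_one_side:
  assumes W: "kcut E V W" "W \<noteq> U" "W \<subseteq> U \<union> A" and W': "kcut E V W'" "W' \<noteq> U" "W' \<subseteq> U \<union> A"
    and sub: "R W \<subseteq> R W'"
  shows "\<exists>D\<in>sides E V W'. D \<subseteq> R W' \<and> W \<subseteq> W' \<union> D"
proof -
  obtain x where x: "x \<in> R W" using R_nonempty[OF W] by blast
  then obtain D where D: "D \<in> sides E V W'" "D \<noteq> S W'" "x \<in> D"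
    using sub unfolding sideR_def by blast
  have DR: "D \<subseteq> R W'" using D unfolding sideR_def by blast
  then have "D \<subseteq> A" using R_subset[OF W'] by blast
  then have "V - (W' \<union> W) - D \<inter> R W \<noteq> {}" using B_nonempty W(3) W'(3) by blast
  then have ge: "\<kappa> \<le> card (W' \<inter> R W) + card (W' \<inter> W) + card (W \<inter> D)"
    using kappa_le_corner[OF kcut_subset[OF W'(1)] kcut_subset[OF W(1)] detached_side[OF D(1)]
        detached_R[OF W]] D(3) x by blast
  have "W' \<inter> R W = {}" using sub R_subset[OF W'] by blast
  moreover have "card ((W \<inter> W') \<union> (W \<inter> D)) = card (W \<inter> W') + card (W \<inter> D)"
    using kcut_finite[OF W(1)] side_subset[OF D(1)] by (intro card_Un_disjoint) auto
  ultimately have "card W \<le> card ((W \<inter> W') \<union> (W \<inter> D))"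
    using ge kcut_card[OF W(1)] by (simp add: Int_commute)
  then have "(W \<inter> W') \<union> (W \<inter> D) = W"
    using kcut_finite[OF W(1)] by (intro card_seteq) auto
  then show ?thesis using D(1) DR by blast
qed

lemma maximal_sideR_disjoint:
  assumes notsmall: "\<not> small_I E V U (\<kappa> - 1)"
    and notwheel: "\<not> (\<exists>w T C i j. is_wheel E V w T C \<and> i < w \<and> j < w \<and> i \<noteq> j \<and>
                                 U = C i \<union> T \<union> C j)"
    and nomatch: "\<not> (\<exists>P W. matching_cut E V U A P W)"
    and m1: "maximalL E V U A W1" and m2: "maximalL E V U A W2" and neq: "W1 \<noteq> W2"
  shows "R W1 \<inter> R W2 = {}"
proof (rule ccontr)
  assume RR: "R W1 \<inter> R W2 \<noteq> {}"
  have L: "W1 \<in> famL E V U A" "W2 \<in> famL E V U A" using m1 m2 unfolding maximalL_def by auto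
  note W1 = famLD(1-3)[OF L(1)] and W2 = famLD(1-3)[OF L(2)]
  have R1: "V - W1 - S W1 = R W1" and R2: "V - W2 - S W2 = R W2" using R_eq W1 W2 by auto
  let ?K = "corner W1 (S W1) W2 (S W2)"
  have SS: "B \<subseteq> S W1 \<inter> S W2" using B_subset_S W1 W2 by blast
  have SSne: "S W1 \<inter> S W2 \<noteq> {}" using SS B_nonempty by blast
  have K: "kcut E V ?K"
    using uncross(1)[OF W1(1) W2(1) detached_S[OF W1] detached_S[OF W2] SSne] RR R1 R2 by simp
  have dK: "detached ?K (S W1 \<inter> S W2)" by (rule detached_corner[OF detached_S[OF W1] detached_S[OF W2]])
  have KUA: "?K \<subseteq> U \<union> A" using W1(3) W2(3) unfolding corner_def by blast
  \<comment> \<open>Thus the cut \<open>?K\<close> leaves both \<open>R W1\<close> and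
    \<open>R W2\<close> beyond \<open>S W1 \<inter> S W2\<close>; as a member of the family it would
    dominate both maximal cuts.\<close>
  have compl: "V - ?K - S W1 \<inter> S W2 = R W1 \<union> R W2"
    using R1 R2 unfolding corner_def by blast
  show False
  proof (cases "?K = U")
    case False
    note K' = K False KUA
    have "S ?K \<subseteq> S W1 \<inter> S W2"
      using side_subset_or_disjoint[OF S_side[OF K'] dK] SS B_subset_S[OF K'] B_nonempty by blast
    then have RK: "R W1 \<union> R W2 \<subseteq> R ?K" using compl R_eq[OF K'] by blast
    have "\<not> small_I E V ?K (\<kappa> - 1)"
      unfolding not_small_I_iff
    proof
      fix D assume D: "D \<in> sides E V ?K"
      \<comment> \<open>Omitting \<open>S ?K\<close> leaves the large set \<open>R W1\<close>;
        omitting another side leaves \<open>B\<close>, which is large since \<open>U\<close> is not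
        small.\<close>
      have "R W1 \<subseteq> V - ?K - D \<or> B \<subseteq> V - ?K - D"
      proof (cases "D = S ?K")
        case True
        then show ?thesis using RK R_eq[OF K'] by blast
      next
        case neqD: False
        then have "D \<inter> S ?K = {}" using sides_disjoint[OF D S_side[OF K']] by blast
        then show ?thesis using B_subset_S[OF K'] KUA by blast
      qed
      moreover have "\<kappa> \<le> card (R W1)" using famLD(4)[OF L(1)] .
      moreover have "\<kappa> - 1 < card B"
        using notsmall Aside B_eq unfolding not_small_I_iff by auto
      moreover have "finite (V - ?K - D)" using finite_V by simp
      \<comment> \<open>Handles truncated subtraction: at \<kappa> = 0 the bound on
        \<open>card (R W1)\<close> alone gives no strict inequality.\<close>
      moreover have "0 < card (R W1)"
        using R_nonempty[OF W1] R_subset[OF W1] A_subset finite_subset_V[of "R W1"]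
        by (auto simp: card_gt_0_iff)
      ultimately show "\<kappa> - 1 < card (V - ?K - D)"
        using card_mono[of "V - ?K - D" "R W1"] card_mono[of "V - ?K - D" B] by linarith
    qed
    then have "?K \<in> famL E V U A" unfolding famL_def using K' by blast
    then have "?K = W1" "?K = W2" using m1 m2 RK unfolding maximalL_def by blast+
    then show False using neq by simp
  next
    case True
    \<comment> \<open>Now \<open>A\<close> is a side of \<open>?K\<close>, so the union of sides
      \<open>S W1 \<inter> S W2\<close> contains it or misses it. Without matching cuts both
      \<open>S W1\<close> and \<open>S W2\<close> meet \<open>A\<close>, which then makes the two
      mixed corners nonempty.\<close>
    have "A \<inter> (S W1 \<inter> S W2) = {}"
    proof -
      have "\<not> A \<subseteq> S W1 \<inter> S W2" using RR R1 R_subset[OF W1] by blast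
      then show ?thesis using side_subset_or_disjoint[OF Aside, of "S W1 \<inter> S W2"] dK True by auto
    qed
    moreover have "S W1 \<inter> A \<noteq> {}" "S W2 \<inter> A \<noteq> {}"
      using nomatch matching_cut_if_S_disjoint[OF W1] matching_cut_if_S_disjoint[OF W2] by blast+
    moreover have "A \<subseteq> S W1 \<inter> S W2 \<union> R W1 \<union> R W2" using compl True A_subset by blast
    ultimately have "S W1 \<inter> R W2 \<noteq> {}" "R W1 \<inter> S W2 \<noteq> {}"
      using R1 R2 by blast+
    then show False
      using four_wheel_corner[OF W1(1) W2(1) neq detached_S[OF W1] detached_S[OF W2] SSne]
        RR R1 R2 True notwheel by simp
  qed
qed

end

theorem theorem5:
  fixes E :: "'a \<Rightarrow> 'a \<Rightarrow> bool" and V U A :: "'a set"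
  assumes graph: "simple_graph E V"
    and conn: "graph_connected E V"
    and noncomplete: "\<not> graph_complete E V"
    and kappa_small: "4 * kappa E V < card V"
    and Ucut: "kcut E V U"
    and Unotsmall: "\<not> small_I E V U (kappa E V - 1)"
    and Unotwheel: "\<not> (\<exists>w T C i j. is_wheel E V w T C \<and> i < w \<and> j < w \<and> i \<noteq> j \<and>
                                 U = C i \<union> T \<union> C j)"
    and Aside: "A \<in> sides E V U"
    and Abig: "card A > 2 * kappa E V"
  shows
    "((\<exists>P W. matching_cut E V U A P W) \<longrightarrow>
        (let Q = \<Union>(Theta_star E V U A);
             M = Match E V U A Q;
             X = (U - Q) \<union> M
         in \<forall>W\<in>famL E V U A.
              W \<subseteq> X \<union> (A - M)
              \<or> (\<exists>P. matching_cut E V U A P W)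
              \<or> crossing_matching_cut E V X W))
     \<and>
     (\<not> (\<exists>P W. matching_cut E V U A P W) \<longrightarrow>
        (\<forall>W\<in>famL E V U A.
            maximalL E V U A W
            \<or> (\<exists>Wi D. maximalL E V U A Wi \<and> D \<in> sides E V Wi \<and>
                      D \<subseteq> sideR E V U A Wi \<and> is_cut E V W \<and> W \<subseteq> Wi \<union> D))
        \<and> (\<forall>Wi Wj. maximalL E V U A Wi \<and> maximalL E V U A Wj \<and> Wi \<noteq> Wj \<longrightarrow>
                   sideR E V U A Wi \<inter> sideR E V U A Wj = {}))"
proof -
  interpret cut_with_side E V U A
    using graph Ucut Aside by unfold_locales
  show ?thesis
  proof (intro conjI impI)
    assume ex: "\<exists>P W. matching_cut E V U A P W"
    define Q where "Q = \<Union>(Theta_star E V U A)"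
    \<comment> \<open>The same choice as inside \<open>Match\<close>, so that
      \<open>(U - Q) \<union> M\<close> is the chosen matching cut itself.\<close>
    define X where "X = (SOME W. matching_cut E V U A Q W)"
    have "matching_cut E V U A Q X"
      unfolding X_def Q_def by (rule someI_ex[OF matching_cut_Union_Theta_star[OF Abig ex]])
    note mX = this and dX = matching_cutD[OF this]
    have M: "Match E V U A Q = X - U" by (simp add: Match_def X_def)
    have X_eq: "(U - Q) \<union> (X - U) = X" using dX(4) by blast
    have "W \<subseteq> X \<union> (A - (X - U)) \<or> (\<exists>P. matching_cut E V U A P W) \<or> crossing_matching_cut E V X W"
      if W: "W \<in> famL E V U A" for W
    proof (cases "W \<inter> Q = {}")
      case True
      then show ?thesis using famLD(3)[OF W] dX(4) by blast
    next
      case False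
      then show ?thesis using crossing_or_matching[OF Abig mX W] by blast
    qed
    then show "let Q = \<Union>(Theta_star E V U A); M = Match E V U A Q; X = (U - Q) \<union> M
         in \<forall>W\<in>famL E V U A. W \<subseteq> X \<union> (A - M) \<or> (\<exists>P. matching_cut E V U A P W)
              \<or> crossing_matching_cut E V X W"
      unfolding Let_def Q_def[symmetric] M X_eq by blast
  next
    show "\<forall>W\<in>famL E V U A. maximalL E V U A W
            \<or> (\<exists>Wi D. maximalL E V U A Wi \<and> D \<in> sides E V Wi \<and>
                      D \<subseteq> sideR E V U A Wi \<and> is_cut E V W \<and> W \<subseteq> Wi \<union> D)"
    proof
      fix W assume W: "W \<in> famL E V U A"
      obtain Wi where Wi: "maximalL E V U A Wi" "R W \<subseteq> R Wi" using below_maximal[OF W] by blast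
      then have WiL: "Wi \<in> famL E V U A" by (simp add: maximalL_def)
      show "maximalL E V U A W \<or> (\<exists>Wi D. maximalL E V U A Wi \<and> D \<in> sides E V Wi \<and>
                      D \<subseteq> sideR E V U A Wi \<and> is_cut E V W \<and> W \<subseteq> Wi \<union> D)"
        using laminar_in_one_side[OF famLD(1-3)[OF W] famLD(1-3)[OF WiL] Wi(2)] Wi(1)
          famLD(1)[OF W] unfolding kcut_def by blast
    qed
  next
    assume "\<not> (\<exists>P W. matching_cut E V U A P W)"
    then show "\<forall>Wi Wj. maximalL E V U A Wi \<and> maximalL E V U A Wj \<and> Wi \<noteq> Wj \<longrightarrow>
                   sideR E V U A Wi \<inter> sideR E V U A Wj = {}"
      using maximal_sideR_disjoint[OF Unotsmall Unotwheel] by blast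
  qed
qed

end
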